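(* Let $R$ be a finite non-commutative ring, let $S$ and $K$ be two subrings of $R$, and let $r \in \{[s,k] : s\in S, k\in K\}$. Then \[ {\Pr}_r(S,K) = \frac{1}{|S||K|}\sum_{\substack{s\in S\\ r\in [s,K]}}|C_K(s)| = \frac{1}{|S|}\sum_{\substack{s\in S\\ r\in [s,K]}}\frac{1}{|[s,K]|}. \]
   Context: Rings are associative and need not have an identity; a subring is an additive subgroup closed under multiplication. $[x,y] := xy-yx$ is the additive commutator. For subrings $S,K$ of $R$ and $r\in R$, ${\Pr}_r(S,K) := \frac{|\{(s,k)\in S\times K : [s,k]=r\}|}{|S\times K|}$. For $s\in R$, $[s,K] := \{[s,k] : k\in K\}$ (this is an additive subgroup of $(R,+)$), and $C_K(s) := \{k\in K : ks = sk\}$. *)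

theory Defs
  imports Complex_Main
begin

text \<open>The type class \<open>ring\<close> does not provide a multiplicative identity, so the ring $R$
  is modelled by a type of this class; likewise subrings need not contain an identity.\<close>

definition is_subring :: "'a::ring set \<Rightarrow> bool" where
  "is_subring S \<longleftrightarrow>
     0 \<in> S \<and> (\<forall>x\<in>S. \<forall>y\<in>S. x + y \<in> S) \<and> (\<forall>x\<in>S. - x \<in> S) \<and> (\<forall>x\<in>S. \<forall>y\<in>S. x * y \<in> S)"

definition comm :: "'a::ring \<Rightarrow> 'a \<Rightarrow> 'a" where
  "comm x y = x * y - y * x"

definition comm_set :: "'a::ring \<Rightarrow> 'a set \<Rightarrow> 'a set" where
  "comm_set s K = {comm s k | k. k \<in> K}"

definition centralizer_in :: "'a::ring set \<Rightarrow> 'a \<Rightarrow> 'a set" where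
  "centralizer_in K s = {k \<in> K. k * s = s * k}"

definition comm_prob :: "'a::ring \<Rightarrow> 'a set \<Rightarrow> 'a set \<Rightarrow> real" where
  "comm_prob r S K = real (card {(s, k) \<in> S \<times> K. comm s k = r}) / real (card (S \<times> K))"

end

theory Submission
  imports Defs
begin

text \<open>For fixed \<open>s\<close> the map \<open>k \<mapsto> [s, k]\<close> is additive on \<open>K\<close> with kernel \<open>C\<^sub>K(s)\<close>, so each of its
  non-empty fibres is a coset of \<open>C\<^sub>K(s)\<close>. Counting the pairs with \<open>[s, k] = r\<close> fibrewise gives the
  first equality, and Lagrange's \<open>|K| = |[s, K]| |C\<^sub>K(s)|\<close> gives the second.\<close>

lemma card_fibre_comm:
  fixes K :: "'a::{ring, finite} set"
  assumes K: "is_subring K" and r: "r \<in> comm_set s K"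
  shows "card {k \<in> K. comm s k = r} = card (centralizer_in K s)"
proof -
  obtain k0 where k0: "k0 \<in> K" "r = comm s k0"
    using r by (auto simp: comm_set_def)
  \<comment> \<open>\<open>k0\<close> is a particular solution. By additivity of
    \<open>comm s\<close>, an element \<open>k\<close> of \<open>K\<close> is another one iff
    \<open>comm s (- k0 + k) = 0\<close>, that is, iff \<open>- k0 + k\<close> commutes with
    \<open>s\<close>.\<close>
  have "{k \<in> K. comm s k = r} = (+) k0 ` centralizer_in K s"
  proof (intro equalityI subsetI)
    fix k assume k: "k \<in> {k \<in> K. comm s k = r}"
    have "- k0 \<in> K" "k \<in> K"
      using K k k0 by (auto simp: is_subring_def)
    then have "- k0 + k \<in> K"
      using K unfolding is_subring_def by blast
    moreover have "(- k0 + k) * s = s * (- k0 + k)"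
      using k k0 by (simp add: comm_def algebra_simps)
    ultimately have "- k0 + k \<in> centralizer_in K s"
      by (simp add: centralizer_in_def)
    then show "k \<in> (+) k0 ` centralizer_in K s"
      by (rule rev_image_eqI) simp
  next
    fix k assume "k \<in> (+) k0 ` centralizer_in K s"
    then show "k \<in> {k \<in> K. comm s k = r}"
      using K k0 by (auto simp: is_subring_def centralizer_in_def comm_def algebra_simps)
  qed
  then show ?thesis
    by (simp add: card_image)
qed

lemma card_comm_set_mult_centralizer:
  fixes K :: "'a::{ring, finite} set"
  assumes "is_subring K"
  shows "card K = card (comm_set s K) * card (centralizer_in K s)"
proof -
  have img: "comm_set s K = comm s ` K"
    by (auto simp: comm_set_def)
  \<comment> \<open>The fibres of \<open>comm s\<close> partition \<open>K\<close>; summing the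
    constant 1 over them counts \<open>K\<close>.\<close>
  have "card K = (\<Sum>r \<in> comm_set s K. card {k \<in> K. comm s k = r})"
    using sum.image_gen[of K "\<lambda>_. 1 :: nat" "comm s"] by (simp add: img)
  also have "\<dots> = card (comm_set s K) * card (centralizer_in K s)"
    using assms by (simp add: card_fibre_comm)
  finally show ?thesis .
qed

text \<open>Group the pairs by first coordinate: an \<open>s\<close> with \<open>r\<close> outside
  \<open>comm_set s K\<close> contributes none, and any other contributes a full fibre, as large as
  its centralizer.\<close>

lemma card_comm_pairs:
  fixes S K :: "'a::{ring, finite} set"
  assumes "is_subring K"
  shows "card {(s, k) \<in> S \<times> K. comm s k = r}
           = (\<Sum>s \<in> {s \<in> S. r \<in> comm_set s K}. card (centralizer_in K s))"
proof -
  have "{(s, k) \<in> S \<times> K. comm s k = r}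
          = (SIGMA s:{s \<in> S. r \<in> comm_set s K}. {k \<in> K. comm s k = r})"
    by (auto simp: comm_set_def)
  then show ?thesis
    using assms by (simp add: card_fibre_comm)
qed

theorem theorem2p5:
  fixes S K :: "'a::{ring, finite} set" and r :: 'a
  assumes noncomm: "\<exists>x y :: 'a. x * y \<noteq> y * x"
    and S: "is_subring S"
    and K: "is_subring K"
    and r: "r \<in> {comm s k | s k. s \<in> S \<and> k \<in> K}"
  shows "comm_prob r S K
           = 1 / (real (card S) * real (card K))
               * (\<Sum>s \<in> {s \<in> S. r \<in> comm_set s K}. real (card (centralizer_in K s)))
       \<and> 1 / (real (card S) * real (card K))
               * (\<Sum>s \<in> {s \<in> S. r \<in> comm_set s K}. real (card (centralizer_in K s)))
           = 1 / real (card S)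
               * (\<Sum>s \<in> {s \<in> S. r \<in> comm_set s K}. 1 / real (card (comm_set s K)))"
proof
  show "comm_prob r S K
          = 1 / (real (card S) * real (card K))
              * (\<Sum>s \<in> {s \<in> S. r \<in> comm_set s K}. real (card (centralizer_in K s)))"
    unfolding comm_prob_def card_comm_pairs[OF K] by (simp add: card_cartesian_product)
next
  \<comment> \<open>Since \<open>K\<close> is finite and nonempty, both factors in Lagrange's
    equation are nonzero, so the centralizer cancels from the quotient below.\<close>
  have "0 \<in> K"
    using K by (simp add: is_subring_def)
  then have "card K \<noteq> 0"
    by auto
  then have "real (card (centralizer_in K s)) / real (card K) = 1 / real (card (comm_set s K))" for s
    using card_comm_set_mult_centralizer[OF K, of s] by simp
  then have "(\<Sum>s \<in> {s \<in> S. r \<in> comm_set s K}. real (card (centralizer_in K s))) / real (card K)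
      = (\<Sum>s \<in> {s \<in> S. r \<in> comm_set s K}. 1 / real (card (comm_set s K)))"
    by (simp add: sum_divide_distrib)
  then show "1 / (real (card S) * real (card K))
              * (\<Sum>s \<in> {s \<in> S. r \<in> comm_set s K}. real (card (centralizer_in K s)))
           = 1 / real (card S)
              * (\<Sum>s \<in> {s \<in> S. r \<in> comm_set s K}. 1 / real (card (comm_set s K)))"
    \<comment> \<open>Swapping the factors of the denominator lets the sum be divided by
      \<open>card K\<close> first, which is where the equality just shown applies.\<close>
    by (simp flip: divide_divide_eq_left add: mult.commute[of "real (card S)"])
qed

end
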